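(* Let $(X,\Sigma)$ be a measurable space, let $k\geq1$ be an integer, and let $\mathfrak{D}^{(k)}:X^\infty\to X^\infty$ be the $k$-dilation $$(x_0,x_1,\ldots)\mapsto(\underbrace{x_0,\ldots,x_0}_{k},\underbrace{x_1,\ldots,x_1}_{k},\ldots).$$ Then for any probability measure $\mu$ on $(X^\infty,\Sigma^\infty)$, $$H^{ip}(\mathfrak{D}^{(k)}_*\mu)=\frac1k H^{ip}(\mu),$$ where $\mathfrak{D}^{(k)}_*\mu$ is the push-forward of $\mu$ under $\mathfrak{D}^{(k)}$.
   Context: Let $(X,\Sigma)$ be a measurable space; $X^\infty=\prod_{n=0}^\infty X$ carries the product $\sigma$-algebra $\Sigma^\infty$. A partition of a measurable space is a finite collection of pairwise disjoint measurable sets whose union is the whole space. For a probability measure $\nu$ and a partition $\mathcal{P}=\{A_i\}_{i=1}^k$, the Shannon entropy is $H^{sh}(\nu,\mathcal{P})=-\sum_{i=1}^k\nu(A_i)\log\nu(A_i)$ (with $0\log 0=0$). For $A_0,\ldots,A_{n-1}\in\Sigma$ put $\overline{A_0\cdots A_{n-1}}=A_0\times\cdots\times A_{n-1}\times X\times X\times\cdots\subseteq X^\infty$; for a partition $\mathcal{P}=\{A_i\}_{i\in I}$ of $X$ let $\overline{\mathcal{P}}^n=\{\overline{A_{i_0}\cdots A_{i_{n-1}}}:i_0,\ldots,i_{n-1}\in I\}$, a partition of $X^\infty$. For a probability measure $\mu$ on $(X^\infty,\Sigma^\infty)$, the infinite-product entropy is defined by $H^{ip}(\mu,\mathcal{P})=\limsup_{n\to\infty}\frac1n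 H^{sh}(\mu,\overline{\mathcal{P}}^n)$ and $H^{ip}(\mu)=\sup_{\mathcal{P}}H^{ip}(\mu,\mathcal{P})\in[0,\infty]$, the supremum over all partitions $\mathcal{P}$ of $X$. *)

theory Defs
  imports "HOL-Probability.Probability"
begin

text \<open>
  A measurable space \<open>(X, \<Sigma>)\<close> is represented by \<open>M :: 'a measure\<close>, of which only
  \<open>space M\<close> and \<open>sets M\<close> matter.
\<close>

abbreviation seq_space :: "'a measure \<Rightarrow> (nat \<Rightarrow> 'a) measure" where
  "seq_space M \<equiv> \<Pi>\<^sub>M n\<in>(UNIV :: nat set). M"

text \<open>Unlike \<^const>\<open>partition_on\<close>, a partition may contain the empty set.\<close>

definition measurable_partition :: "'a measure \<Rightarrow> 'a set set \<Rightarrow> bool" where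
  "measurable_partition M P \<longleftrightarrow>
     finite P \<and> P \<subseteq> sets M \<and> disjoint P \<and> \<Union>P = space M"

text \<open>The convention \<open>0 log 0 = 0\<close> is automatic since the factor \<open>0\<close> annihilates \<open>ln 0\<close>.\<close>

definition shannon_entropy :: "'a measure \<Rightarrow> 'a set set \<Rightarrow> real" where
  "shannon_entropy N P = - (\<Sum>A\<in>P. measure N A * ln (measure N A))"

definition cylinder :: "'a measure \<Rightarrow> nat \<Rightarrow> (nat \<Rightarrow> 'a set) \<Rightarrow> (nat \<Rightarrow> 'a) set" where
  "cylinder M n A = (\<Pi>\<^sub>E i\<in>UNIV. if i < n then A i else space M)"

definition cylinder_partition :: "'a measure \<Rightarrow> 'a set set \<Rightarrow> nat \<Rightarrow> (nat \<Rightarrow> 'a) set set" where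
  "cylinder_partition M P n = {cylinder M n A | A. \<forall>i<n. A i \<in> P}"

definition ip_entropy_wrt :: "'a measure \<Rightarrow> (nat \<Rightarrow> 'a) measure \<Rightarrow> 'a set set \<Rightarrow> ereal" where
  "ip_entropy_wrt M \<mu> P =
     limsup (\<lambda>n. ereal (1 / real n * shannon_entropy \<mu> (cylinder_partition M P n)))"

definition ip_entropy :: "'a measure \<Rightarrow> (nat \<Rightarrow> 'a) measure \<Rightarrow> ereal" where
  "ip_entropy M \<mu> = (SUP P\<in>{P. measurable_partition M P}. ip_entropy_wrt M \<mu> P)"

text \<open>Coordinate \<open>n\<close> of the dilated sequence lies in the block with index \<open>n div k\<close>.\<close>

definition dilation :: "nat \<Rightarrow> (nat \<Rightarrow> 'a) \<Rightarrow> (nat \<Rightarrow> 'a)" where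
  "dilation k x = (\<lambda>n. x (n div k))"

text \<open>
  Measurability of the dilation makes \<^const>\<open>distr\<close> along it the genuine push-forward.
\<close>

lemma measurable_dilation: "dilation k \<in> measurable (seq_space M) (seq_space M)"
  unfolding dilation_def by (rule measurable_PiM_single') (auto simp: space_PiM)

lemma measurable_partition_cylinder_partition:
  assumes P: "measurable_partition M P"
  shows "measurable_partition (seq_space M) (cylinder_partition M P n)"
proof -
  have fin: "finite P" and sub: "P \<subseteq> sets M" and dis: "disjoint P" and un: "\<Union>P = space M"
    using P by (auto simp: measurable_partition_def)
  have "cylinder_partition M P n \<subseteq> cylinder M n ` (\<Pi>\<^sub>E i\<in>{..<n}. P)"
  proof
    fix C assume "C \<in> cylinder_partition M P n"
    then obtain A where A: "C = cylinder M n A" "\<forall>i<n. A i \<in> P"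
      by (auto simp: cylinder_partition_def)
    then have "C = cylinder M n (restrict A {..<n})" "restrict A {..<n} \<in> (\<Pi>\<^sub>E i\<in>{..<n}. P)"
      by (auto simp: cylinder_def intro!: PiE_cong)
    then show "C \<in> cylinder M n ` (\<Pi>\<^sub>E i\<in>{..<n}. P)" by blast
  qed
  then have 1: "finite (cylinder_partition M P n)"
    using fin by (meson finite_PiE finite_imageI finite_lessThan finite_subset)
  have 2: "cylinder_partition M P n \<subseteq> sets (seq_space M)"
    using subsetD[OF sub]
    by (auto simp: cylinder_partition_def cylinder_def intro!: sets_PiM_I_countable)
  have 3: "disjoint (cylinder_partition M P n)"
  proof (rule disjointI)
    fix C D assume "C \<in> cylinder_partition M P n" "D \<in> cylinder_partition M P n" "C \<noteq> D"
    then obtain A B where AB: "C = cylinder M n A" "D = cylinder M n B"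
        "\<forall>i<n. A i \<in> P" "\<forall>i<n. B i \<in> P" "cylinder M n A \<noteq> cylinder M n B"
      unfolding cylinder_partition_def by blast
    have "\<exists>i<n. A i \<noteq> B i"
    proof (rule ccontr)
      assume "\<not> ?thesis"
      then have "(\<lambda>i. if i < n then A i else space M) = (\<lambda>i. if i < n then B i else space M)"
        by (auto simp: fun_eq_iff)
      with AB(5) show False by (simp add: cylinder_def)
    qed
    then obtain i where i: "i < n" "A i \<noteq> B i" by blast
    have "A i \<inter> B i = {}" using disjointD[OF dis _ _ i(2)] AB(3,4) i(1) by simp
    moreover have "x i \<in> A i \<inter> B i" if "x \<in> C \<inter> D" for x
      using that i(1) by (auto simp: AB(1,2) cylinder_def PiE_iff dest!: spec[of _ i])
    ultimately show "C \<inter> D = {}" by blast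
  qed
  have "\<exists>A. (\<forall>i<n. A i \<in> P) \<and> x \<in> cylinder M n A" if x: "x \<in> space (seq_space M)" for x
  proof -
    have xi: "x i \<in> space M" for i using x by (auto simp: space_PiM PiE_iff)
    then have "\<forall>i. \<exists>A. A \<in> P \<and> x i \<in> A" using un by blast
    then obtain A where "\<forall>i. A i \<in> P \<and> x i \<in> A i" by metis
    with xi show ?thesis by (intro exI[of _ A]) (auto simp: cylinder_def PiE_iff)
  qed
  then have 4: "space (seq_space M) \<subseteq> \<Union>(cylinder_partition M P n)"
    unfolding cylinder_partition_def by blast
  show ?thesis
    unfolding measurable_partition_def
  proof (intro conjI equalityI Union_least)
    show "C \<subseteq> space (seq_space M)" if "C \<in> cylinder_partition M P n" for C
      using that 2 sets.sets_into_space by blast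
  qed (fact 1 2 3 4)+
qed

end

theory Submission
  imports Defs
begin

text \<open>
  Pulling a cylinder of length \<open>n\<close> over \<open>P\<close> back along the dilation imposes
  \<open>x j \<in> A i\<close> for all \<open>i < n\<close> in the \<open>j\<close>-th block, so by disjointness of \<open>P\<close> it is either empty
  or a cylinder of length \<open>\<lceil>n / k\<rceil>\<close>, and every such cylinder arises. Empty sets do not contribute
  to the entropy, hence the \<open>n\<close>-th entropy of the push-forward is the \<open>\<lceil>n / k\<rceil>\<close>-th entropy of \<open>\<mu>\<close>.
  Since \<open>\<lceil>n / k\<rceil> / n\<close> tends to \<open>1 / k\<close>, the upper entropy rates differ by the factor \<open>1 / k\<close>.
\<close>

text \<open>The ceiling of \<open>n / k\<close> for \<open>k \<ge> 1\<close>: the number of blocks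
  of length \<open>k\<close> that meet the coordinates below \<open>n\<close>.\<close>

definition ceil_div :: "nat \<Rightarrow> nat \<Rightarrow> nat" where
  "ceil_div n k = (n + (k - 1)) div k"

text \<open>Block \<open>j\<close> starts at coordinate \<open>j * k\<close>, so it meets the first
  \<open>n\<close> coordinates exactly when this coordinate is among them.\<close>

lemma less_ceil_div_iff: "k \<ge> 1 \<Longrightarrow> j < ceil_div n k \<longleftrightarrow> j * k < n"
  using less_eq_div_iff_mult_less_eq[of k "Suc j" "n + (k - 1)"]
  by (auto simp: ceil_div_def Suc_le_eq)

lemma ceil_div_mult:
  assumes "k \<ge> 1"
  shows "ceil_div (k * m) k = m"
proof -
  have "j < ceil_div (k * m) k \<longleftrightarrow> j < m" for j
    using assms by (simp add: less_ceil_div_iff mult.commute)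
  then show ?thesis
    by (meson less_irrefl linorder_neqE_nat)
qed

lemma ceil_div_bounds:
  assumes "k \<ge> 1"
  shows "n \<le> ceil_div n k * k" "ceil_div n k * k \<le> n + k"
proof -
  show "n \<le> ceil_div n k * k"
    \<comment> \<open>Block number \<open>ceil_div n k\<close> is the first one lying entirely
      beyond the coordinates below \<open>n\<close>.\<close>
    using less_ceil_div_iff[OF assms, of "ceil_div n k" n] by simp
  show "ceil_div n k * k \<le> n + k"
    using div_times_less_eq_dividend[of "n + (k - 1)" k] assms
    unfolding ceil_div_def by linarith
qed

lemma ceil_div_ratio_tendsto:
  assumes "k \<ge> 1"
  shows "(\<lambda>n. real (ceil_div n k) / real n) \<longlonglongrightarrow> 1 / real k"
proof (rule tendsto_sandwich)
  show "\<forall>\<^sub>F n in sequentially. 1 / real k \<le> real (ceil_div n k) / real n"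
    using eventually_gt_at_top[of 0]
  proof eventually_elim
    case (elim n)
    have "real n \<le> real (ceil_div n k * k)"
      using ceil_div_bounds(1)[OF assms] by (simp only: of_nat_le_iff)
    with elim assms show ?case by (simp add: field_simps)
  qed
  show "\<forall>\<^sub>F n in sequentially. real (ceil_div n k) / real n \<le> 1 / real k + 1 / real n"
    using eventually_gt_at_top[of 0]
  proof eventually_elim
    case (elim n)
    have "real (ceil_div n k * k) \<le> real (n + k)"
      using ceil_div_bounds(2)[OF assms] by (simp only: of_nat_le_iff)
    with elim assms show ?case by (simp add: field_simps)
  qed
  show "(\<lambda>n. 1 / real k + 1 / real n) \<longlonglongrightarrow> 1 / real k"
    using tendsto_add[OF tendsto_const lim_1_over_n, of "1 / real k"] by simp
qed simp

text \<open>A predicate eventually true along \<open>G\<close> pulls back along \<open>g\<close> to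
  one eventually true along \<open>F\<close>, and the supremum of \<open>f \<circ> g\<close> over
  the pullback only sees values of \<open>f\<close> on the original predicate.\<close>

lemma Limsup_compose_filterlim_le:
  fixes f :: "'b \<Rightarrow> 'c :: complete_lattice"
  assumes "filterlim g G F"
  shows "Limsup F (\<lambda>x. f (g x)) \<le> Limsup G f"
  unfolding Limsup_def
proof (rule INF_greatest)
  fix P assume "P \<in> {P. eventually P G}"
  then have "eventually (\<lambda>x. P (g x)) F"
    using assms by (auto simp: filterlim_iff)
  then show "(INF P\<in>{P. eventually P F}. SUP x\<in>{x. P x}. f (g x)) \<le> (SUP x\<in>{x. P x}. f x)"
    by (intro INF_lower2[of "\<lambda>x. P (g x)"]) (auto intro!: SUP_least SUP_upper)
qed

lemma filterlim_ceil_div: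
  assumes "k \<ge> 1"
  shows "filterlim (\<lambda>n. ceil_div n k) at_top sequentially"
  unfolding filterlim_at_top
proof
  fix m
  show "\<forall>\<^sub>F n in sequentially. m \<le> ceil_div n k"
    using eventually_ge_at_top[of "m * k"]
  proof eventually_elim
    case (elim n)
    then have "m * k \<le> ceil_div n k * k"
      using ceil_div_bounds(1)[OF assms, of n] by linarith
    with assms show ?case by simp
  qed
qed

lemma limsup_compose_ceil_div:
  fixes a :: "nat \<Rightarrow> 'a :: complete_linorder"
  assumes "k \<ge> 1"
  shows "limsup (\<lambda>n. a (ceil_div n k)) = limsup a"
proof (rule antisym)
  show "limsup (\<lambda>n. a (ceil_div n k)) \<le> limsup a"
    by (rule Limsup_compose_filterlim_le[OF filterlim_ceil_div[OF assms]])
  \<comment> \<open>Along \<open>n = k * m\<close> the ceiling is exactly \<open>m\<close>, so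
    \<open>a\<close> is itself a subsequence of the composed sequence.\<close>
  have "strict_mono (\<lambda>m. k * m)"
    using assms by (auto simp: strict_mono_def)
  from limsup_subseq_mono[OF this, of "\<lambda>n. a (ceil_div n k)"]
  show "limsup a \<le> limsup (\<lambda>n. a (ceil_div n k))"
    using assms by (simp add: comp_def ceil_div_mult)
qed

text \<open>Write \<open>1 / n\<close> as \<open>(ceil_div n k / n) * (1 / ceil_div n k)\<close>.
  The first factor has a positive finite limit and so leaves the limsup, even an infinite
  one.\<close>

lemma limsup_ceil_div_rate:
  fixes h :: "nat \<Rightarrow> real"
  assumes "k \<ge> 1"
  shows "limsup (\<lambda>n. ereal (1 / real n * h (ceil_div n k))) =
    ereal (1 / real k) * limsup (\<lambda>n. ereal (1 / real n * h n))"
proof -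
  let ?a = "\<lambda>m. ereal (1 / real m * h m)"
  have "limsup (\<lambda>n. ereal (1 / real n * h (ceil_div n k))) =
      limsup (\<lambda>n. ereal (real (ceil_div n k) / real n) * ?a (ceil_div n k))"
  proof (rule Limsup_eq)
    show "\<forall>\<^sub>F n in sequentially. ereal (1 / real n * h (ceil_div n k)) =
        ereal (real (ceil_div n k) / real n) * ?a (ceil_div n k)"
      using eventually_gt_at_top[of 0]
    proof eventually_elim
      case (elim n)
      \<comment> \<open>Needed to cancel \<open>ceil_div n k\<close>; block 0 is met once
        \<open>n > 0\<close>.\<close>
      then have "ceil_div n k \<noteq> 0"
        using less_ceil_div_iff[OF assms, of 0 n] by simp
      then show ?case by simp
    qed
  qed
  also have "\<dots> = ereal (1 / real k) * limsup (\<lambda>n. ?a (ceil_div n k))"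
    using assms by (intro ereal_limsup_lim_mult tendsto_ereal ceil_div_ratio_tendsto) auto
  also have "limsup (\<lambda>n. ?a (ceil_div n k)) = limsup ?a"
    by (rule limsup_compose_ceil_div[OF assms])
  finally show ?thesis .
qed

lemma shannon_entropy_remove_empty:
  assumes "finite P"
  shows "shannon_entropy N P = shannon_entropy N (P - {{}})"
  unfolding shannon_entropy_def using assms
  by (intro arg_cong[where f = uminus] sum.mono_neutral_right) auto

text \<open>Taking the image set merges cells with equal preimages. By disjointness this happens
  only for empty preimages, whose terms vanish, so the remaining sum can be reindexed.\<close>

lemma shannon_entropy_distr:
  assumes f: "f \<in> measurable N N'" and P: "measurable_partition N' P"
  shows "shannon_entropy (distr N N' f) P = shannon_entropy N ((\<lambda>C. f -` C \<inter> space N) ` P - {{}})"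
proof -
  let ?g = "\<lambda>C. f -` C \<inter> space N"
  let ?Q = "{C \<in> P. ?g C \<noteq> {}}"
  have fin: "finite P" and sub: "P \<subseteq> sets N'" and dis: "disjoint P"
    using P by (auto simp: measurable_partition_def)
  have inj: "inj_on ?g ?Q"
  proof (rule inj_onI)
    fix C D assume CD: "C \<in> ?Q" "D \<in> ?Q" "?g C = ?g D"
    then have "C \<inter> D \<noteq> {}" by blast
    with CD dis show "C = D" by (auto dest: disjointD)
  qed
  have "(\<Sum>C\<in>P. measure (distr N N' f) C * ln (measure (distr N N' f) C)) =
      (\<Sum>C\<in>P. measure N (?g C) * ln (measure N (?g C)))"
    using sub by (intro sum.cong refl) (simp add: measure_distr[OF f] subset_eq)
  also have "\<dots> = (\<Sum>C\<in>?Q. measure N (?g C) * ln (measure N (?g C)))"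
    using fin by (intro sum.mono_neutral_right) auto
  also have "\<dots> = (\<Sum>C\<in>?g ` ?Q. measure N C * ln (measure N C))"
    by (simp add: sum.reindex[OF inj])
  also have "?g ` ?Q = ?g ` P - {{}}" by auto
  finally show ?thesis by (simp add: shannon_entropy_def)
qed

lemma cylinder_eq:
  assumes "\<And>i. i < n \<Longrightarrow> A i \<subseteq> space M"
  shows "cylinder M n A = {x \<in> space (seq_space M). \<forall>i<n. x i \<in> A i}"
proof -
  have "(\<forall>i. x i \<in> (if i < n then A i else space M)) \<longleftrightarrow>
      (\<forall>i. x i \<in> space M) \<and> (\<forall>i<n. x i \<in> A i)" for x
  proof (intro iffI conjI allI impI)
    fix i assume *: "\<forall>i. x i \<in> (if i < n then A i else space M)"
    show "x i \<in> space M" using spec[OF *, of i] assms[of i] by (auto split: if_splits)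
    show "x i \<in> A i" if "i < n" using spec[OF *, of i] that by simp
  qed auto
  then show ?thesis by (simp add: cylinder_def space_PiM PiE_UNIV_domain Pi_iff set_eq_iff)
qed

text \<open>When \<open>A\<close> is constant on blocks, all conditions within block
  \<open>j\<close> reduce to the single condition \<open>x j \<in> B j\<close>.\<close>

lemma dilation_vimage_cylinder:
  assumes k: "k \<ge> 1" and AB: "\<And>i. i < n \<Longrightarrow> A i = B (i div k)"
    and B: "\<And>j. j < ceil_div n k \<Longrightarrow> B j \<subseteq> space M"
  shows "dilation k -` cylinder M n A \<inter> space (seq_space M) = cylinder M (ceil_div n k) B"
proof -
  have div: "i div k < ceil_div n k" if "i < n" for i
    using that less_ceil_div_iff[OF k] le_less_trans[OF div_times_less_eq_dividend] by blast
  have A: "A i \<subseteq> space M" if "i < n" for i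
    using AB[OF that] B[OF div[OF that]] by simp
  have "(\<forall>i<n. x (i div k) \<in> A i) \<longleftrightarrow> (\<forall>j<ceil_div n k. x j \<in> B j)" for x
  proof
    assume x: "\<forall>i<n. x (i div k) \<in> A i"
    show "\<forall>j<ceil_div n k. x j \<in> B j"
    proof (intro allI impI)
      \<comment> \<open>The condition on \<open>x j\<close> is read off at the first coordinate of
        its block, the last block being possibly cut short by \<open>n\<close>.\<close>
      fix j assume "j < ceil_div n k"
      then have "j * k < n" by (simp add: less_ceil_div_iff[OF k])
      from x[rule_format, OF this] AB[OF this] k show "x j \<in> B j" by simp
    qed
  next
    assume "\<forall>j<ceil_div n k. x j \<in> B j"
    then show "\<forall>i<n. x (i div k) \<in> A i" using AB div by simp
  qed
  moreover have "dilation k x \<in> space (seq_space M)" if "x \<in> space (seq_space M)" for x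
    using measurable_space[OF measurable_dilation that] .
  ultimately show ?thesis
    using A B by (subst (1 2) cylinder_eq) (auto simp: dilation_def)
qed

lemma dilation_vimage_cylinder_partition:
  assumes k: "k \<ge> 1" and P: "measurable_partition M P"
  shows "(\<lambda>C. dilation k -` C \<inter> space (seq_space M)) ` cylinder_partition M P n - {{}} =
    cylinder_partition M P (ceil_div n k) - {{}}" (is "?g ` _ - _ = _")
proof -
  have dis: "disjoint P" and sp: "\<And>A. A \<in> P \<Longrightarrow> A \<subseteq> space M"
    using P by (auto simp: measurable_partition_def)
  have "?g C \<in> cylinder_partition M P (ceil_div n k)"
    if C: "C \<in> cylinder_partition M P n" and ne: "?g C \<noteq> {}" for C
  proof -
    from C obtain A where A: "C = cylinder M n A" "\<And>i. i < n \<Longrightarrow> A i \<in> P"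
      by (auto simp: cylinder_partition_def)
    from ne obtain x where "dilation k x \<in> cylinder M n A"
      using A(1) by blast
    then have x: "x (i div k) \<in> A i" if "i < n" for i
      using that A(2) sp by (subst (asm) cylinder_eq) (auto simp: dilation_def)
    \<comment> \<open>The first coordinate of each block represents the block.\<close>
    define B where "B j = A (j * k)" for j
    have B: "B j \<in> P" if "j < ceil_div n k" for j
      using that A(2) by (simp add: B_def less_ceil_div_iff[OF k])
    have "A i = B (i div k)" if i: "i < n" for i
    proof -
      have i': "i div k * k < n"
        using i div_times_less_eq_dividend[of i k] by linarith
      \<comment> \<open>A point of the preimage lies in both cells prescribed within one block, so
        disjointness makes these cells equal.\<close>
      have "x (i div k) \<in> A i \<inter> A (i div k * k)"
        using x[OF i] x[OF i'] k by simp
      then show ?thesis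
        using disjointD[OF dis A(2)[OF i] A(2)[OF i']] by (auto simp: B_def)
    qed
    then have "?g C = cylinder M (ceil_div n k) B"
      unfolding A(1) by (intro dilation_vimage_cylinder k sp B)
    with B show ?thesis by (auto simp: cylinder_partition_def)
  qed
  moreover have "D \<in> ?g ` cylinder_partition M P n"
    if "D \<in> cylinder_partition M P (ceil_div n k)" for D
  proof -
    from that obtain B where B: "D = cylinder M (ceil_div n k) B" "\<And>j. j < ceil_div n k \<Longrightarrow> B j \<in> P"
      by (auto simp: cylinder_partition_def)
    \<comment> \<open>Conversely, repeating \<open>B j\<close> throughout block \<open>j\<close>
      gives a cylinder whose preimage is \<open>D\<close>.\<close>
    have "D = ?g (cylinder M n (\<lambda>i. B (i div k)))"
      unfolding B(1) by (intro dilation_vimage_cylinder[symmetric] k sp B(2)) auto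
    moreover have "i div k < ceil_div n k" if "i < n" for i
      using that less_ceil_div_iff[OF k] le_less_trans[OF div_times_less_eq_dividend] by blast
    ultimately show ?thesis
      using B(2) by (auto simp: cylinder_partition_def)
  qed
  ultimately show ?thesis by blast
qed

lemma shannon_entropy_dilation:
  assumes k: "k \<ge> 1" and P: "measurable_partition M P" and S: "sets \<mu> = sets (seq_space M)"
  shows "shannon_entropy (distr \<mu> (seq_space M) (dilation k)) (cylinder_partition M P n) =
    shannon_entropy \<mu> (cylinder_partition M P (ceil_div n k))"
proof -
  have "finite (cylinder_partition M P (ceil_div n k))"
    using measurable_partition_cylinder_partition[OF P] by (simp add: measurable_partition_def)
  note remove_empty = shannon_entropy_remove_empty[OF this, of \<mu>]
  have "dilation k \<in> measurable \<mu> (seq_space M)"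
    using measurable_dilation measurable_cong_sets[OF S refl] by blast
  from shannon_entropy_distr[OF this measurable_partition_cylinder_partition[OF P], of n]
  show ?thesis
    by (simp only: sets_eq_imp_space_eq[OF S] dilation_vimage_cylinder_partition[OF k P] remove_empty)
qed

theorem proposition2p7:
  fixes M :: "'a measure" and \<mu> :: "(nat \<Rightarrow> 'a) measure" and k :: nat
  assumes "k \<ge> 1"
    and "prob_space \<mu>"
    and "sets \<mu> = sets (seq_space M)"
  shows "ip_entropy M (distr \<mu> (seq_space M) (dilation k)) = ereal (1 / real k) * ip_entropy M \<mu>"
proof -
  \<comment> \<open>Moving the scalar out of the supremum uses a nonempty index family. The trivial
    partition qualifies even for empty \<open>space M\<close>, since empty cells are
    allowed.\<close>
  have "measurable_partition M {space M}"
    by (auto simp: measurable_partition_def)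
  then have ne: "{P. measurable_partition M P} \<noteq> {}" by blast
  have "ip_entropy_wrt M (distr \<mu> (seq_space M) (dilation k)) P =
      ereal (1 / real k) * ip_entropy_wrt M \<mu> P" if "measurable_partition M P" for P
    unfolding ip_entropy_wrt_def shannon_entropy_dilation[OF assms(1) that assms(3)]
    by (rule limsup_ceil_div_rate[OF assms(1)])
  then have "ip_entropy M (distr \<mu> (seq_space M) (dilation k)) =
      (SUP P\<in>{P. measurable_partition M P}. ereal (1 / real k) * ip_entropy_wrt M \<mu> P)"
    unfolding ip_entropy_def by (intro SUP_cong) auto
  also have "\<dots> = ereal (1 / real k) * ip_entropy M \<mu>"
    unfolding ip_entropy_def by (rule Sup_ereal_mult_left'[OF ne, symmetric]) simp
  finally show ?thesis .
qed

end
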